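(* Let $\Omega\subset\mathbb{R}^n$ be a bounded, Lipschitz, open set, $M\in(1,+\infty)$, $m\in[-|\Omega|,|\Omega|]$, $s\in(0,1)$ and $\epsilon\in(0,1)$. Let $u_\epsilon\in Z_{M,m}$ satisfy $\mathcal{F}_\epsilon(u_\epsilon,\Omega)=\min\{\mathcal{F}_\epsilon(v,\Omega): v\in Z_{M,m}\}$. Then $$u_\epsilon(x)=\frac{\displaystyle\int_\Omega\frac{u_\epsilon(y)}{|x-y|^{n+2s}}dy}{\displaystyle\int_\Omega\frac{1}{|x-y|^{n+2s}}dy}\qquad\text{for a.e. }x\in\Omega^c.$$
   Context: Potential: $W:\mathbb{R}\to[0,+\infty)$, $W\in C^2(\mathbb{R})$, $W(\pm1)=0$, $W>0$ in $\mathbb{R}\setminus\{\pm1\}$, $W'(\pm1)=0$, $W''(\pm1)>0$. Space: $Z_{M,m}:=\{u\in L^1_{\rm loc}(\mathbb{R}^n):\|u\|_{L^\infty(\Omega)}\le M,\ \int_\Omega u\,dx=m\}$. Energies ($\Omega^c$ is the complement of $\Omega$ in $\mathbb{R}^n$): $$\mathcal{K}(u,\Omega):=\frac12\int_\Omega\int_\Omega\frac{|u(x)-u(y)|^2}{|x-y|^{n+2s}}dxdy+\int_\Omega\int_{\Omega^c}\frac{|u(x)-u(y)|^2}{|x-y|^{n+2s}}dxdy,$$ $$\mathcal{F}_\epsilon(u,\Omega):=\kappa_\epsilon\Big(\epsilon^{2s}\mathcal{K}(u,\Omega)+\int_\Omega W(u)\,dx\Big),$$ with $\kappa_\epsilon:=\epsilon^{-2s}$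 if $s\in(0,\frac12)$, $\kappa_\epsilon:=|\epsilon\log\epsilon|^{-1}$ if $s=\frac12$, $\kappa_\epsilon:=\epsilon^{-1}$ if $s\in(\frac12,1)$. *)

theory Defs
  imports "HOL-Probability.Essential_Supremum"
begin

definition C2_function :: "(real \<Rightarrow> real) \<Rightarrow> bool" where
  "C2_function W \<longleftrightarrow>
     W differentiable_on UNIV \<and>
     deriv W differentiable_on UNIV \<and>
     continuous_on UNIV (deriv (deriv W))"

definition double_well_potential :: "(real \<Rightarrow> real) \<Rightarrow> bool" where
  "double_well_potential W \<longleftrightarrow>
     C2_function W \<and>
     (\<forall>t. 0 \<le> W t) \<and>
     W (-1) = 0 \<and> W 1 = 0 \<and>
     (\<forall>t. t \<notin> {-1, 1} \<longrightarrow> 0 < W t) \<and>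
     deriv W (-1) = 0 \<and> deriv W 1 = 0 \<and>
     0 < deriv (deriv W) (-1) \<and> 0 < deriv (deriv W) 1"

(* The boundary is locally the graph of a Lipschitz function and the set lies locally on
   one side of it. The rotated coordinate frame is encoded by its last axis, the unit vector e:
   x \<bullet> e is the last coordinate and x - (x \<bullet> e) *\<^sub>R e, which ranges over the hyperplane
   orthogonal to e, stands for the first n - 1 coordinates. For n = 1 the hyperplane is {0}. *)
definition lipschitz_set :: "(real ^ 'n) set \<Rightarrow> bool" where
  "lipschitz_set \<Omega> \<longleftrightarrow>
     (\<forall>p \<in> frontier \<Omega>. \<exists>e r L g.
        norm e = 1 \<and> 0 < r \<and>
        L-lipschitz_on {z. z \<bullet> e = 0} (g :: real ^ 'n \<Rightarrow> real) \<and>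
        \<Omega> \<inter> ball p r = {x \<in> ball p r. g (x - (x \<bullet> e) *\<^sub>R e) < x \<bullet> e})"

definition L1_loc :: "(real ^ 'n \<Rightarrow> real) set" where
  "L1_loc = {u. \<forall>K. compact K \<longrightarrow> u absolutely_integrable_on K}"

definition Linfty_norm_on :: "(real ^ 'n) set \<Rightarrow> (real ^ 'n \<Rightarrow> real) \<Rightarrow> ereal" where
  "Linfty_norm_on \<Omega> u = esssup (lebesgue_on \<Omega>) (\<lambda>x. ereal \<bar>u x\<bar>)"

definition admissible :: "real \<Rightarrow> real \<Rightarrow> (real ^ 'n) set \<Rightarrow> (real ^ 'n \<Rightarrow> real) set" where
  "admissible M m \<Omega> =
     {u \<in> L1_loc. Linfty_norm_on \<Omega> u \<le> ereal M \<and> (LINT x:\<Omega>|lebesgue. u x) = m}"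

(* The energies take values in [0,\<infinity>], since the double integrals may diverge.
   On the diagonal x = y the quotients below evaluate to 0; the diagonal is a null set. *)
definition kinetic_energy ::
  "real \<Rightarrow> (real ^ 'n \<Rightarrow> real) \<Rightarrow> (real ^ 'n) set \<Rightarrow> ennreal" where
  "kinetic_energy s u \<Omega> =
     ennreal (1 / 2) *
       (\<integral>\<^sup>+x\<in>\<Omega>. (\<integral>\<^sup>+y\<in>\<Omega>.
          ennreal (\<bar>u x - u y\<bar>\<^sup>2 / norm (x - y) powr (real CARD('n) + 2 * s)) \<partial>lebesgue) \<partial>lebesgue) +
     (\<integral>\<^sup>+x\<in>\<Omega>. (\<integral>\<^sup>+y\<in>- \<Omega>.
        ennreal (\<bar>u x - u y\<bar>\<^sup>2 / norm (x - y) powr (real CARD('n) + 2 * s)) \<partial>lebesgue) \<partial>lebesgue)"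

definition kappa :: "real \<Rightarrow> real \<Rightarrow> real" where
  "kappa s \<epsilon> =
     (if s < 1 / 2 then \<epsilon> powr (- 2 * s)
      else if s = 1 / 2 then inverse \<bar>\<epsilon> * ln \<epsilon>\<bar>
      else inverse \<epsilon>)"

definition total_energy ::
  "(real \<Rightarrow> real) \<Rightarrow> real \<Rightarrow> real \<Rightarrow> (real ^ 'n \<Rightarrow> real) \<Rightarrow> (real ^ 'n) set \<Rightarrow> ennreal" where
  "total_energy W s \<epsilon> u \<Omega> =
     ennreal (kappa s \<epsilon>) *
       (ennreal (\<epsilon> powr (2 * s)) * kinetic_energy s u \<Omega> +
        (\<integral>\<^sup>+x\<in>\<Omega>. ennreal (W (u x)) \<partial>lebesgue))"

end

theory Submission
  imports Defs
begin

text \<open>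
  For \<open>x\<close> at positive distance from \<open>\<Omega>\<close>, let \<open>\<mu>\<^sub>x\<close> be the finite measure
  \<open>dy / |x - y| powr (n + 2s)\<close> on \<open>\<Omega>\<close>. The kernel-weighted mean \<open>t(x)\<close> of \<open>u\<close> minimises
  \<open>c \<mapsto> \<integral> |c - u|\<^sup>2 d\<mu>\<^sub>x\<close>, and the excess at \<open>c\<close> is exactly \<open>\<mu>\<^sub>x(\<Omega>) |c - t(x)|\<^sup>2\<close>.
  Replacing \<open>u\<close> by \<open>t\<close> off \<open>closure \<Omega>\<close> keeps it admissible, because neither the mass nor the
  bound sees the values off \<open>\<Omega>\<close>, and lowers the energy by the integral of that excess.
  Since the minimal energy is finite (compare with a constant), the excess vanishes
  almost everywhere; the boundary is a null set, being locally a Lipschitz graph.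
\<close>

section \<open>Product measurability for Lebesgue measure\<close>

lemma sigma_finite_lebesgue: "sigma_finite_measure (lebesgue :: 'a::euclidean_space measure)"
proof
  have "emeasure lebesgue (ball (0::'a) (real n)) \<noteq> \<infinity>" for n
    using lmeasurable_ball[of "0::'a" "real n"] fmeasurableD2 by (metis infinity_ennreal_def)
  moreover have "(\<Union>n. ball (0::'a) (real n)) = UNIV"
    by (auto intro: reals_Archimedean2)
  ultimately show "\<exists>A. countable A \<and> A \<subseteq> sets lebesgue \<and> \<Union> A = space (lebesgue :: 'a measure) \<and>
      (\<forall>a\<in>A. emeasure lebesgue a \<noteq> \<infinity>)"
    by (intro exI[of _ "range (\<lambda>n. ball (0::'a) (real n))"]) auto
qed

lemma pair_sigma_finite_lebesgue:
  "pair_sigma_finite (lebesgue :: 'a::euclidean_space measure) (lebesgue :: 'b::euclidean_space measure)"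
  by (intro pair_sigma_finite.intro sigma_finite_lebesgue)

lemma borel_measurable_ident_lebesgue [measurable]:
  "(\<lambda>x. x) \<in> borel_measurable (lebesgue :: 'a::euclidean_space measure)"
  by (rule measurable_completion) simp

text \<open>Fubini needs the kernel measurable for the product of two completed measures. The
  identity is measurable from Lebesgue to Borel sets, hence so are both projections, and the norm of
  their difference follows.\<close>

lemma borel_measurable_pair_dist [measurable]:
  "(\<lambda>z. norm (fst z - snd z :: 'a::euclidean_space)) \<in> borel_measurable (lebesgue \<Otimes>\<^sub>M lebesgue)"
proof -
  note m = borel_measurable_ident_lebesgue
  have [measurable]: "fst \<in> borel_measurable (lebesgue \<Otimes>\<^sub>M lebesgue :: ('a \<times> 'a) measure)"
    "snd \<in> borel_measurable (lebesgue \<Otimes>\<^sub>M lebesgue :: ('a \<times> 'a) measure)"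
    using measurable_compose[OF measurable_fst m] measurable_compose[OF measurable_snd m]
    by (simp_all add: eta_contract_eq)
  show ?thesis by measurable
qed

section \<open>A Lipschitz boundary is a null set\<close>

text \<open>Near each of its points the boundary lies in the graph of \<open>g\<close> over the
  hyperplane orthogonal to \<open>e\<close>. The graph map \<open>G\<close> sends this null
  hyperplane into the same space and is Lipschitz there, so its image is null.\<close>

lemma negligible_frontier_lipschitz_set:
  fixes \<Omega> :: "(real ^ 'n) set"
  assumes "open \<Omega>" "lipschitz_set \<Omega>"
  shows "negligible (frontier \<Omega>)"
proof (subst locally_negligible_alt, intro ballI)
  fix p assume p: "p \<in> frontier \<Omega>"
  then obtain e r L g where e: "norm e = 1" and r: "0 < r"
    and L: "L-lipschitz_on {z. z \<bullet> e = 0} (g :: real ^ 'n \<Rightarrow> real)"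
    and eq: "\<Omega> \<inter> ball p r = {x \<in> ball p r. g (x - (x \<bullet> e) *\<^sub>R e) < x \<bullet> e}"
    using bspec[OF assms(2)[unfolded lipschitz_set_def] p] by (elim exE conjE) (rule that)
  have ee: "e \<bullet> e = 1" using e by (simp add: dot_square_norm)
  define P where "P x = x - (x \<bullet> e) *\<^sub>R e" for x
  have P0: "P x \<bullet> e = 0" for x
    by (simp add: P_def inner_diff_left ee)
  have cont: "continuous_on UNIV (\<lambda>x. g (P x) - x \<bullet> e)"
  proof (intro continuous_intros)
    show "continuous_on UNIV (\<lambda>x. g (P x))"
      by (rule continuous_on_compose2[OF lipschitz_on_continuous_on[OF L]])
        (use P0 in \<open>auto simp: P_def[abs_def] intro!: continuous_intros\<close>)
  qed
  define G where "G z = z + g z *\<^sub>R e" for z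
  \<comment> \<open>A boundary point is outside the open set \<open>\<Omega>\<close>, so off the
    graph it would lie strictly below it. By continuity this persists on a neighbourhood
    \<open>U\<close> disjoint from \<open>\<Omega>\<close>, against \<open>x\<close> being in the
    closure.\<close>
  have on_graph: "g (P x) = x \<bullet> e" if x: "x \<in> frontier \<Omega>" "x \<in> ball p r" for x
  proof (rule ccontr)
    assume ne: "g (P x) \<noteq> x \<bullet> e"
    have "x \<notin> \<Omega>"
      using x(1) assms(1) by (simp add: frontier_def interior_open)
    with x(2) eq have "g (P x) > x \<bullet> e"
      using ne unfolding P_def by fastforce
    moreover define U where "U = {y. 0 < g (P y) - y \<bullet> e} \<inter> ball p r"
    ultimately have "x \<in> U" using x(2) by simp
    have "open U"
      unfolding U_def using cont by (intro open_Int open_ball open_Collect_less) auto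
    moreover have "U \<inter> \<Omega> = {}"
    proof (rule equals0I)
      fix y assume "y \<in> U \<inter> \<Omega>"
      then have "y \<in> \<Omega> \<inter> ball p r" "y \<bullet> e < g (P y)" by (auto simp: U_def)
      then show False unfolding eq by (simp add: P_def)
    qed
    ultimately have "U \<inter> closure \<Omega> = {}"
      using open_Int_closure_eq_empty by blast
    then show False using \<open>x \<in> U\<close> x(1) by (auto simp: frontier_def)
  qed
  have "negligible {z. e \<bullet> z = 0}"
    by (rule negligible_hyperplane) (use e in auto)
  then have hyp: "negligible {z. z \<bullet> e = 0}"
    by (simp add: inner_commute)
  have "negligible (G ` {z. z \<bullet> e = 0})"
  proof (rule negligible_locally_Lipschitz_image[OF _ hyp])
    fix x assume "x \<in> {z. z \<bullet> e = 0}"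
    \<comment> \<open>The identity part of \<open>G\<close> contributes 1, the part along the unit
      vector \<open>e\<close> contributes \<open>L\<close>.\<close>
    have "norm (G y - G x) \<le> (1 + L) * norm (y - x)" if "y \<in> {z. z \<bullet> e = 0}" for y
    proof -
      have "\<bar>g y - g x\<bar> \<le> L * norm (y - x)"
        using lipschitz_onD[OF L that \<open>x \<in> _\<close>] by (simp add: dist_norm)
      moreover have "norm (G y - G x) \<le> norm (y - x) + norm ((g y - g x) *\<^sub>R e)"
        unfolding G_def by (rule order_trans[OF _ norm_triangle_ineq]) (simp add: algebra_simps)
      moreover have "norm ((g y - g x) *\<^sub>R e) = \<bar>g y - g x\<bar>" using e by simp
      ultimately show ?thesis unfolding distrib_right by linarith
    qed
    then show "\<exists>T B. open T \<and> x \<in> T \<and>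
        (\<forall>y\<in>{z. z \<bullet> e = 0} \<inter> T. norm (G y - G x) \<le> B * norm (y - x))"
      by (intro exI[of _ UNIV] exI[of _ "1 + L"]) auto
  qed simp
  moreover have "frontier \<Omega> \<inter> ball p r \<subseteq> G ` {z. z \<bullet> e = 0}"
  proof
    fix x assume "x \<in> frontier \<Omega> \<inter> ball p r"
    then have "x = G (P x)" using on_graph by (simp add: G_def P_def)
    then show "x \<in> G ` {z. z \<bullet> e = 0}" using P0 by blast
  qed
  ultimately have "negligible (frontier \<Omega> \<inter> ball p r)"
    by (rule negligible_subset)
  then show "\<exists>U. openin (top_of_set (frontier \<Omega>)) U \<and> p \<in> U \<and> negligible U"
    using p r by (intro exI[of _ "frontier \<Omega> \<inter> ball p r"]) auto
qed

section \<open>Weighted mean and variance\<close>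

text \<open>As a function of \<open>d\<close>, the weighted integral of the squared distance of
  \<open>f\<close> to \<open>d\<close> is a quadratic polynomial with leading coefficient the total
  weight and vertex \<open>t\<close>. The bound on \<open>f\<close> is asked only where
  \<open>w\<close> is nonzero, so that a weight supported in \<open>\<Omega>\<close> can be paired
  with a function bounded only there.\<close>

lemma
  fixes w f :: "'a \<Rightarrow> real"
  assumes w: "integrable M w" and w0: "\<And>x. 0 \<le> w x" and A: "0 < (LINT x|M. w x)"
    and f [measurable]: "f \<in> borel_measurable M" and B: "AE x in M. w x \<noteq> 0 \<longrightarrow> \<bar>f x\<bar> \<le> B"
  defines "t \<equiv> (LINT x|M. f x * w x) / (LINT x|M. w x)"
  shows abs_weighted_mean_le: "\<bar>t\<bar> \<le> B"
    and weighted_variance_split: "(\<integral>\<^sup>+x. ennreal (\<bar>f x - c\<bar>\<^sup>2 * w x) \<partial>M) =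
      (\<integral>\<^sup>+x. ennreal (\<bar>f x - t\<bar>\<^sup>2 * w x) \<partial>M) + ennreal ((LINT x|M. w x) * \<bar>c - t\<bar>\<^sup>2)"
proof -
  have [measurable]: "w \<in> borel_measurable M" using w by simp
  define A where "A = (LINT x|M. w x)"
  have bd: "AE x in M. \<bar>f x\<bar> * w x \<le> B * w x"
    using B by eventually_elim (use w0 in \<open>auto intro: mult_right_mono\<close>)
  have wB: "integrable M (\<lambda>x. B * w x)" using w by simp
  have fw: "integrable M (\<lambda>x. f x * w x)"
  proof (rule Bochner_Integration.integrable_bound[OF wB])
    show "AE x in M. norm (f x * w x) \<le> norm (B * w x)"
      using bd
      by eventually_elim (use w0 in \<open>auto simp: abs_mult intro: order_trans[OF _ mult_right_mono[OF abs_ge_self]]\<close>)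
  qed measurable
  \<comment> \<open>The bound is used a second time: the integrand with the square of
    \<open>f\<close> is dominated by \<open>B\<close> times the one with \<open>f\<close>, already
    known to be integrable.\<close>
  have wB2: "integrable M (\<lambda>x. B * \<bar>f x * w x\<bar>)" using fw by simp
  have ffw: "integrable M (\<lambda>x. (f x)\<^sup>2 * w x)"
  proof (rule Bochner_Integration.integrable_bound[OF wB2])
    show "AE x in M. norm ((f x)\<^sup>2 * w x) \<le> norm (B * \<bar>f x * w x\<bar>)"
      using bd
    proof eventually_elim
      case (elim x)
      from mult_right_mono[OF this abs_ge_zero[of "f x"]]
      have "\<bar>f x\<bar> * w x * \<bar>f x\<bar> \<le> B * w x * \<bar>f x\<bar>" .
      moreover have "norm ((f x)\<^sup>2 * w x) = \<bar>f x\<bar> * w x * \<bar>f x\<bar>"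
        using w0[of x] by (simp add: abs_mult power2_eq_square)
      moreover have "B * w x * \<bar>f x\<bar> \<le> norm (B * \<bar>f x * w x\<bar>)"
        using w0[of x] mult_right_mono[OF abs_ge_self[of B], of "w x * \<bar>f x\<bar>"]
        by (simp add: abs_mult mult_ac)
      ultimately show ?case by linarith
    qed
  qed measurable
  have "\<bar>LINT x|M. f x * w x\<bar> \<le> (LINT x|M. \<bar>f x * w x\<bar>)"
    by simp
  also have "\<dots> \<le> (LINT x|M. B * w x)"
    by (intro integral_mono_AE integrable_abs fw wB) (use bd w0 in \<open>simp add: abs_mult\<close>)
  finally have "\<bar>LINT x|M. f x * w x\<bar> \<le> B * A" by (simp add: A_def)
  then show "\<bar>t\<bar> \<le> B"
    using assms(3) unfolding t_def A_def[symmetric] by (simp add: abs_div_pos[symmetric] pos_divide_le_eq)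
  have tA: "(LINT x|M. f x * w x) = t * A"
    using assms(3) unfolding t_def A_def[symmetric] by simp
  have expand: "\<bar>f x - d\<bar>\<^sup>2 * w x = (f x)\<^sup>2 * w x - 2 * d * (f x * w x) + d\<^sup>2 * w x" for x d
    by (simp add: power2_eq_square algebra_simps)
  have int: "integrable M (\<lambda>x. \<bar>f x - d\<bar>\<^sup>2 * w x)" for d
    unfolding expand using w fw ffw by simp
  have val: "(LINT x|M. \<bar>f x - d\<bar>\<^sup>2 * w x) = (LINT x|M. (f x)\<^sup>2 * w x) - 2 * d * (t * A) + d\<^sup>2 * A" for d
    unfolding expand using w fw ffw by (simp add: tA A_def)
  \<comment> \<open>Integrability turns the extended integrals into real ones, where
    \<open>val\<close> at \<open>d = c\<close> and \<open>d = t\<close> can be subtracted and the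
    square completed.\<close>
  have nn: "(\<integral>\<^sup>+x. ennreal (\<bar>f x - d\<bar>\<^sup>2 * w x) \<partial>M) = ennreal (LINT x|M. \<bar>f x - d\<bar>\<^sup>2 * w x)" for d
    by (rule nn_integral_eq_integral[OF int]) (simp add: w0)
  have "(LINT x|M. \<bar>f x - c\<bar>\<^sup>2 * w x) = (LINT x|M. \<bar>f x - t\<bar>\<^sup>2 * w x) + A * \<bar>c - t\<bar>\<^sup>2"
    unfolding val by (simp add: power2_eq_square algebra_simps)
  then show "(\<integral>\<^sup>+x. ennreal (\<bar>f x - c\<bar>\<^sup>2 * w x) \<partial>M) =
      (\<integral>\<^sup>+x. ennreal (\<bar>f x - t\<bar>\<^sup>2 * w x) \<partial>M) + ennreal ((LINT x|M. w x) * \<bar>c - t\<bar>\<^sup>2)"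
    unfolding nn A_def[symmetric]
    using assms(3) by (simp add: A_def w0 ennreal_plus[symmetric] del: ennreal_plus)
qed

section \<open>Membership in the admissible class\<close>

text \<open>The function is the pointwise limit of its truncations to the balls of radius
  \<open>i\<close>, each of which is integrable.\<close>

lemma L1_loc_borel_measurable:
  fixes u :: "real ^ 'n \<Rightarrow> real"
  assumes "u \<in> L1_loc"
  shows "u \<in> borel_measurable lebesgue"
proof (rule borel_measurable_LIMSEQ_real)
  fix i :: nat
  have "u absolutely_integrable_on cball 0 (real i)"
    using assms by (simp add: L1_loc_def)
  then show "(\<lambda>x. indicator (cball 0 (real i)) x * u x) \<in> borel_measurable lebesgue"
    unfolding set_integrable_def by (simp add: borel_measurable_integrable)
next
  fix x :: "real ^ 'n"
  show "(\<lambda>i. indicator (cball 0 (real i)) x * u x) \<longlonglongrightarrow> u x"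
  proof (rule tendsto_eventually)
    obtain N where N: "norm x \<le> real N" using real_arch_simple by blast
    show "\<forall>\<^sub>F i in sequentially. indicator (cball 0 (real i)) x * u x = u x"
      using eventually_ge_at_top[of N]
      by eventually_elim (use N in \<open>auto simp: indicator_def\<close>)
  qed
qed

text \<open>On a compact set \<open>v\<close> is dominated by the integrable function
  \<open>\<bar>u x\<bar> + B\<close>. This keeps the competitor locally integrable.\<close>

lemma L1_loc_bounded_modification:
  fixes u v :: "real ^ 'n \<Rightarrow> real"
  assumes u: "u \<in> L1_loc" and v: "v \<in> borel_measurable lebesgue"
    and B: "0 \<le> B" "\<And>x. v x = u x \<or> \<bar>v x\<bar> \<le> B"
  shows "v \<in> L1_loc"
  unfolding L1_loc_def
proof (intro CollectI allI impI)
  fix K :: "(real ^ 'n) set" assume K: "compact K"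
  then have Ks: "K \<in> lmeasurable" by (simp add: lmeasurable_compact)
  have c: "set_integrable lebesgue K (\<lambda>x. B)"
    using Ks by (simp add: absolutely_integrable_on_const)
  have "set_integrable lebesgue K (\<lambda>x. \<bar>u x\<bar>)"
    using u K by (auto simp: L1_loc_def intro: set_integrable_abs)
  from set_integral_add(1)[OF this c]
  show "v absolutely_integrable_on K"
  proof (rule set_integrable_bound)
    show "set_borel_measurable lebesgue K v"
      unfolding set_borel_measurable_def using v Ks
      by (intro borel_measurable_scaleR borel_measurable_indicator) auto
    show "AE x in lebesgue. x \<in> K \<longrightarrow> norm (v x) \<le> norm (\<bar>u x\<bar> + B)"
      using B by (intro AE_I2) (smt (verit) real_norm_def)
  qed
qed

text \<open>Measurability is assumed because \<open>esssup\<close> is infinite by definition for a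
  non-measurable function.\<close>

lemma Linfty_norm_on_le:
  fixes u :: "real ^ 'n \<Rightarrow> real"
  assumes "\<Omega> \<in> sets lebesgue" "u \<in> borel_measurable lebesgue"
    and "AE x in lebesgue. x \<in> \<Omega> \<longrightarrow> \<bar>u x\<bar> \<le> M"
  shows "Linfty_norm_on \<Omega> u \<le> ereal M"
  unfolding Linfty_norm_on_def
proof (rule esssup_I)
  show "(\<lambda>x. ereal \<bar>u x\<bar>) \<in> borel_measurable (lebesgue_on \<Omega>)"
    using assms(2) by (intro measurable_restrict_space1) simp
  show "AE x in lebesgue_on \<Omega>. ereal \<bar>u x\<bar> \<le> ereal M"
    using assms by (subst AE_restrict_space_iff) auto
qed

lemma Linfty_norm_on_AE:
  fixes u :: "real ^ 'n \<Rightarrow> real"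
  assumes "\<Omega> \<in> sets lebesgue" "Linfty_norm_on \<Omega> u \<le> ereal M"
  shows "AE x in lebesgue. x \<in> \<Omega> \<longrightarrow> \<bar>u x\<bar> \<le> M"
proof -
  have "AE x in lebesgue_on \<Omega>. ereal \<bar>u x\<bar> \<le> ereal M"
    using esssup_AE[of "\<lambda>x. ereal \<bar>u x\<bar>" "lebesgue_on \<Omega>"]
    by eventually_elim (erule order_trans[OF _ assms(2)[unfolded Linfty_norm_on_def]])
  then show ?thesis using assms(1) by (subst (asm) AE_restrict_space_iff) auto
qed

section \<open>The kernel seen from a point off the closure\<close>

text \<open>Such a point has distance at least some \<open>d > 0\<close> from
  \<open>\<Omega>\<close>, so the kernel is at most \<open>1 / d powr p\<close> on a set of finite
  measure.\<close>

lemma kernel_integrable: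
  fixes \<Omega> :: "'a::euclidean_space set"
  assumes "open \<Omega>" "bounded \<Omega>" "x \<notin> closure \<Omega>" "0 \<le> p"
  shows "integrable lebesgue (\<lambda>y. indicator \<Omega> y / norm (x - y) powr p :: real)"
proof -
  obtain d where d: "0 < d" "\<And>y. y \<in> \<Omega> \<Longrightarrow> d \<le> norm (x - y)"
    using assms(3) unfolding closure_approachable
    by (auto simp: dist_norm norm_minus_commute not_less)
  have fin: "\<Omega> \<in> lmeasurable" using assms by (simp add: lmeasurable_open)
  have [measurable]: "\<Omega> \<in> sets lebesgue" using fin by blast
  have "integrable lebesgue (\<lambda>y. (1 / d powr p) * indicator \<Omega> y)"
    using fin by (intro integrable_mult_right) (simp add: integrable_indicator_iff fmeasurable_def)
  then show ?thesis
  proof (rule Bochner_Integration.integrable_bound)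
    have "indicator \<Omega> y / norm (x - y) powr p \<le> (1 / d powr p) * indicator \<Omega> y" for y
    proof (cases "y \<in> \<Omega>")
      case True
      then have "d powr p \<le> norm (x - y) powr p"
        using d by (intro powr_mono2 assms(4)) auto
      then show ?thesis using True d(1) by (simp add: frac_le)
    qed simp
    then show "AE y in lebesgue. norm (indicator \<Omega> y / norm (x - y) powr p :: real)
        \<le> norm ((1 / d powr p) * indicator \<Omega> y :: real)"
      by (intro AE_I2) (simp add: abs_mult)
  qed measurable
qed

text \<open>The kernel is strictly positive on \<open>\<Omega>\<close>, since \<open>x\<close> is
  not in it. A zero integral would make the nonempty open set \<open>\<Omega>\<close> null.\<close>

lemma kernel_integral_pos:
  fixes \<Omega> :: "'a::euclidean_space set"
  assumes "open \<Omega>" "bounded \<Omega>" "\<Omega> \<noteq> {}" "x \<notin> closure \<Omega>" "0 \<le> p"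
  shows "0 < (LINT y|lebesgue. indicator \<Omega> y / norm (x - y) powr p :: real)" (is "0 < integral\<^sup>L _ ?f")
proof -
  have "integral\<^sup>L lebesgue ?f \<noteq> 0"
  proof
    assume "integral\<^sup>L lebesgue ?f = 0"
    then have "AE y in lebesgue. ?f y = 0"
      by (subst (asm) integral_nonneg_eq_0_iff_AE) (use assms in \<open>auto intro: kernel_integrable\<close>)
    then have "AE y in lebesgue. y \<notin> \<Omega>"
      by eventually_elim
        (use assms(4) closure_subset in \<open>auto simp: indicator_def split: if_splits\<close>)
    then have "negligible \<Omega>"
      using assms(1) by (simp add: negligible_iff_null_sets AE_iff_null_sets borel_open)
    then show False using assms open_not_negligible by blast
  qed
  moreover have "0 \<le> integral\<^sup>L lebesgue ?f" by simp
  ultimately show ?thesis by linarith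
qed

section \<open>Exterior energy of the kernel-mean replacement\<close>

text \<open>Apply the variance identity at each exterior point and integrate. The replacement leaves
  \<open>u\<close> alone on the whole closure because at boundary points the kernel may fail to be
  integrable. The splitting is stated as a sum in \<open>[0,\<infinity>]\<close>, so it holds for
  infinite energies too.\<close>

lemma
  fixes \<Omega> :: "'a::euclidean_space set" and u :: "'a \<Rightarrow> real"
  assumes \<Omega>: "open \<Omega>" "bounded \<Omega>" "\<Omega> \<noteq> {}" and p: "0 \<le> p"
    and u [measurable]: "u \<in> borel_measurable lebesgue"
    and M: "AE x in lebesgue. x \<in> \<Omega> \<longrightarrow> \<bar>u x\<bar> \<le> M"
  defines "A \<equiv> \<lambda>x. LINT y:\<Omega>|lebesgue. 1 / norm (x - y) powr p"
  defines "t \<equiv> \<lambda>x. (LINT y:\<Omega>|lebesgue. u y / norm (x - y) powr p) / A x"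
  defines "v \<equiv> \<lambda>x. if x \<in> closure \<Omega> then u x else t x"
  shows borel_measurable_kernel_mean_replacement: "v \<in> borel_measurable lebesgue"
    and abs_kernel_mean_le: "\<And>x. x \<notin> closure \<Omega> \<Longrightarrow> \<bar>t x\<bar> \<le> M"
    and kernel_mass_pos: "\<And>x. x \<notin> closure \<Omega> \<Longrightarrow> 0 < A x"
    and borel_measurable_kernel_excess: "(\<lambda>y. ennreal (A y * \<bar>u y - t y\<bar>\<^sup>2)) \<in> borel_measurable lebesgue"
    and exterior_energy_split:
      "(\<integral>\<^sup>+x\<in>\<Omega>. (\<integral>\<^sup>+y\<in>-\<Omega>. ennreal (\<bar>u x - u y\<bar>\<^sup>2 / norm (x - y) powr p) \<partial>lebesgue) \<partial>lebesgue) =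
       (\<integral>\<^sup>+x\<in>\<Omega>. (\<integral>\<^sup>+y\<in>-\<Omega>. ennreal (\<bar>v x - v y\<bar>\<^sup>2 / norm (x - y) powr p) \<partial>lebesgue) \<partial>lebesgue) +
       (\<integral>\<^sup>+y\<in>-closure \<Omega>. ennreal (A y * \<bar>u y - t y\<bar>\<^sup>2) \<partial>lebesgue)"
proof -
  interpret pair_sigma_finite "lebesgue :: 'a measure" "lebesgue :: 'a measure"
    by (rule pair_sigma_finite_lebesgue)
  have [measurable]: "\<Omega> \<in> sets lebesgue" "closure \<Omega> \<in> sets lebesgue"
    using \<Omega>(1) by auto
  define w where "w x y = indicator \<Omega> y / norm (x - y) powr p" for x y :: 'a
  have w [measurable]: "case_prod w \<in> borel_measurable (lebesgue \<Otimes>\<^sub>M lebesgue)"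
    unfolding w_def[abs_def] case_prod_unfold by measurable
  have A: "A x = (LINT y|lebesgue. w x y)" for x
    by (simp add: A_def w_def set_lebesgue_integral_def)
  have t: "t x = (LINT y|lebesgue. u y * w x y) / (LINT y|lebesgue. w x y)" for x
    by (simp add: t_def A[symmetric])
      (simp add: w_def set_lebesgue_integral_def mult_ac)
  \<comment> \<open>Joint measurability of \<open>w\<close> suffices, even at points where the
    kernel is not integrable: there the integral has the default value 0.\<close>
  have Am [measurable]: "A \<in> borel_measurable lebesgue"
    unfolding A[abs_def] by measurable
  have tm [measurable]: "t \<in> borel_measurable lebesgue"
    unfolding t[abs_def] by measurable
  show vm [measurable]: "v \<in> borel_measurable lebesgue"
    unfolding v_def by measurable
  show em [measurable]: "(\<lambda>y. ennreal (A y * \<bar>u y - t y\<bar>\<^sup>2)) \<in> borel_measurable lebesgue"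
    by measurable
  have wi: "integrable lebesgue (w x)" and w_pos: "0 < (LINT y|lebesgue. w x y)"
    if "x \<notin> closure \<Omega>" for x
    using kernel_integrable[OF \<Omega>(1,2) that p] kernel_integral_pos[OF \<Omega> that p]
    by (simp_all add: w_def[abs_def])
  have w0: "0 \<le> w x y" for x y by (simp add: w_def)
  have wM: "AE y in lebesgue. w x y \<noteq> 0 \<longrightarrow> \<bar>u y\<bar> \<le> M" for x
    using M by eventually_elim (auto simp: w_def indicator_def)
  show "\<bar>t x\<bar> \<le> M" if "x \<notin> closure \<Omega>" for x
    unfolding t by (rule abs_weighted_mean_le[OF wi[OF that] w0 w_pos[OF that] u wM])
  show "0 < A x" if "x \<notin> closure \<Omega>" for x
    using w_pos[OF that] by (simp add: A)
  define I where "I f y = (\<integral>\<^sup>+x\<in>\<Omega>. ennreal (\<bar>f x - f y\<bar>\<^sup>2 / norm (x - y) powr p) \<partial>lebesgue)"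
    for f :: "'a \<Rightarrow> real" and y
  have Im [measurable]: "I f \<in> borel_measurable lebesgue"
    if [measurable]: "f \<in> borel_measurable lebesgue" for f
    unfolding I_def[abs_def] case_prod_unfold norm_minus_commute[of _ "_ :: 'a"] by measurable
  \<comment> \<open>The mean is taken for each exterior point separately, so Tonelli is used to make
    the exterior variable the outer one.\<close>
  have swap: "(\<integral>\<^sup>+x\<in>\<Omega>. (\<integral>\<^sup>+y\<in>-\<Omega>. ennreal (\<bar>f x - f y\<bar>\<^sup>2 / norm (x - y) powr p) \<partial>lebesgue) \<partial>lebesgue)
      = (\<integral>\<^sup>+y\<in>-\<Omega>. I f y \<partial>lebesgue)"
    if [measurable]: "f \<in> borel_measurable lebesgue" for f
  proof -
    have "(\<integral>\<^sup>+x\<in>\<Omega>. (\<integral>\<^sup>+y\<in>-\<Omega>. ennreal (\<bar>f x - f y\<bar>\<^sup>2 / norm (x - y) powr p) \<partial>lebesgue) \<partial>lebesgue)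
      = (\<integral>\<^sup>+x. (\<integral>\<^sup>+y. ennreal (\<bar>f x - f y\<bar>\<^sup>2 / norm (x - y) powr p) * indicator (-\<Omega>) y * indicator \<Omega> x \<partial>lebesgue) \<partial>lebesgue)"
      by (simp add: nn_integral_multc)
    also have "\<dots> = (\<integral>\<^sup>+y. (\<integral>\<^sup>+x. ennreal (\<bar>f x - f y\<bar>\<^sup>2 / norm (x - y) powr p) * indicator (-\<Omega>) y * indicator \<Omega> x \<partial>lebesgue) \<partial>lebesgue)"
      by (rule Fubini'[symmetric]) (unfold case_prod_unfold, measurable)
    also have "\<dots> = (\<integral>\<^sup>+y\<in>-\<Omega>. I f y \<partial>lebesgue)"
    proof (rule nn_integral_cong)
      fix y
      show "(\<integral>\<^sup>+x. ennreal (\<bar>f x - f y\<bar>\<^sup>2 / norm (x - y) powr p) * indicator (-\<Omega>) y * indicator \<Omega> x \<partial>lebesgue)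
          = I f y * indicator (-\<Omega>) y"
        by (cases "y \<in> \<Omega>") (simp_all add: I_def)
    qed
    finally show ?thesis .
  qed
  \<comment> \<open>For \<open>y\<close> in the closure, \<open>v\<close> and \<open>u\<close> agree
    at \<open>y\<close> and on \<open>\<Omega>\<close>, and no excess arises. Otherwise this is the
    variance identity with weight \<open>w y\<close> and \<open>c = u y\<close>, because
    \<open>v\<close> equals \<open>t y\<close> at \<open>y\<close> and \<open>u\<close> on
    \<open>\<Omega>\<close>.\<close>
  have pointwise: "I u y * indicator (-\<Omega>) y =
      I v y * indicator (-\<Omega>) y + ennreal (A y * \<bar>u y - t y\<bar>\<^sup>2) * indicator (-closure \<Omega>) y" for y
  proof (cases "y \<in> closure \<Omega>")
    case True
    have "I v y = I u y"
      unfolding I_def using True closure_subset[of \<Omega>]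
      by (intro nn_integral_cong) (auto simp: v_def indicator_def)
    then show ?thesis using True by simp
  next
    case False
    then have "y \<notin> \<Omega>" using closure_subset by blast
    have conv: "ennreal (a / norm (x - y) powr p) * indicator \<Omega> x = ennreal (a * w y x)" for a x
      by (simp add: w_def indicator_def norm_minus_commute)
    have "I u y = (\<integral>\<^sup>+x. ennreal (\<bar>u x - u y\<bar>\<^sup>2 * w y x) \<partial>lebesgue)"
      unfolding I_def conv ..
    also have "\<dots> = (\<integral>\<^sup>+x. ennreal (\<bar>u x - t y\<bar>\<^sup>2 * w y x) \<partial>lebesgue) + ennreal (A y * \<bar>u y - t y\<bar>\<^sup>2)"
      unfolding t A by (rule weighted_variance_split[OF wi[OF False] w0 w_pos[OF False] u wM])
    also have "(\<integral>\<^sup>+x. ennreal (\<bar>u x - t y\<bar>\<^sup>2 * w y x) \<partial>lebesgue) = I v y"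
      unfolding I_def conv[symmetric] using False closure_subset[of \<Omega>]
      by (intro nn_integral_cong) (auto simp: v_def indicator_def)
    finally show ?thesis using False \<open>y \<notin> \<Omega>\<close> by simp
  qed
  show "(\<integral>\<^sup>+x\<in>\<Omega>. (\<integral>\<^sup>+y\<in>-\<Omega>. ennreal (\<bar>u x - u y\<bar>\<^sup>2 / norm (x - y) powr p) \<partial>lebesgue) \<partial>lebesgue) =
       (\<integral>\<^sup>+x\<in>\<Omega>. (\<integral>\<^sup>+y\<in>-\<Omega>. ennreal (\<bar>v x - v y\<bar>\<^sup>2 / norm (x - y) powr p) \<partial>lebesgue) \<partial>lebesgue) +
       (\<integral>\<^sup>+y\<in>-closure \<Omega>. ennreal (A y * \<bar>u y - t y\<bar>\<^sup>2) \<partial>lebesgue)"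
    unfolding swap[OF u] swap[OF vm] pointwise
    by (rule nn_integral_add) measurable
qed

section \<open>Positivity, finiteness and cancellation for the energy\<close>

lemma kappa_pos: "0 < kappa s \<epsilon>" if "0 < \<epsilon>" "\<epsilon> < 1"
proof -
  have "\<epsilon> * ln \<epsilon> \<noteq> 0" using that by simp
  then show ?thesis using that by (simp add: kappa_def)
qed

text \<open>A constant has no kinetic energy, and its potential part is \<open>W c\<close> times the
  finite measure of \<open>\<Omega>\<close>.\<close>

lemma total_energy_const_finite:
  fixes \<Omega> :: "(real ^ 'n) set"
  assumes "\<Omega> \<in> lmeasurable"
  shows "total_energy W s \<epsilon> (\<lambda>_. c) \<Omega> < top"
proof -
  have "(\<integral>\<^sup>+x\<in>\<Omega>. ennreal (W c) \<partial>lebesgue) < top"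
    using fmeasurableD[OF assms] fmeasurableD2[OF assms]
    by (simp add: nn_integral_cmult_indicator ennreal_mult_less_top less_top del: emeasure_completion)
  then show ?thesis
    by (simp add: total_energy_def kinetic_energy_def ennreal_mult_less_top)
qed

text \<open>Extended nonnegative numbers cancel only when finite. Finiteness of the left side passes
  to \<open>q\<close> and \<open>a + b\<close>, because \<open>K\<close> and \<open>e\<close> are
  positive, and then all common terms can be removed. Here \<open>x\<close> is the excess,
  \<open>a\<close> and \<open>b\<close> are the interior and exterior kinetic parts, and
  \<open>q\<close> is the potential part.\<close>

lemma energy_excess_eq_0:
  fixes a b x q :: ennreal and K e :: real
  assumes "0 < K" "0 < e"
    and le: "ennreal K * (ennreal e * (a + (b + x)) + q) \<le> ennreal K * (ennreal e * (a + b) + q)"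
    and fin: "ennreal K * (ennreal e * (a + (b + x)) + q) < top"
  shows "x = 0"
proof -
  have "ennreal e * (a + (b + x)) + q < top"
    using fin assms(1) by (auto simp: ennreal_mult_less_top)
  then have q: "q < top" and "ennreal e * (a + (b + x)) < top" by auto
  then have ab: "a + b < top" using assms(2) by (auto simp: ennreal_mult_less_top)
  have "ennreal e * (a + (b + x)) + q \<le> ennreal e * (a + b) + q"
    using le assms(1) by (simp add: ennreal_mult_le_mult_iff)
  then have "ennreal e * (a + (b + x)) \<le> ennreal e * (a + b)"
    using q by (auto simp: add.commute[of _ q] ennreal_add_left_cancel_le)
  then have "(a + b) + x \<le> (a + b) + 0"
    using assms(2) by (simp add: ennreal_mult_le_mult_iff add.assoc)
  then show ?thesis
    using ab unfolding ennreal_add_left_cancel_le by auto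
qed

section \<open>Minimality forces the mean value formula\<close>

text \<open>For empty \<open>\<Omega>\<close> all energies are 0 and the quotient is 0/0, which
  evaluates to 0. The constant 1 would then be a minimiser violating the formula, hence the explicit
  nonemptiness.\<close>

theorem theorem2p12:
  fixes \<Omega> :: "(real ^ 'n) set"
    and W :: "real \<Rightarrow> real"
    and M m s \<epsilon> :: real
    and u :: "real ^ 'n \<Rightarrow> real"
  assumes "double_well_potential W"
    and "open \<Omega>" and "bounded \<Omega>" and "lipschitz_set \<Omega>" and "\<Omega> \<noteq> {}"
    and "1 < M"
    and "- measure lebesgue \<Omega> \<le> m" and "m \<le> measure lebesgue \<Omega>"
    and "0 < s" and "s < 1"
    and "0 < \<epsilon>" and "\<epsilon> < 1"
    and "u \<in> admissible M m \<Omega>"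
    and "\<forall>v \<in> admissible M m \<Omega>. total_energy W s \<epsilon> u \<Omega> \<le> total_energy W s \<epsilon> v \<Omega>"
  shows "AE x in lebesgue. x \<in> - \<Omega> \<longrightarrow>
    u x =
      (LINT y:\<Omega>|lebesgue. u y / norm (x - y) powr (real CARD('n) + 2 * s)) /
      (LINT y:\<Omega>|lebesgue. 1 / norm (x - y) powr (real CARD('n) + 2 * s))"
proof -
  define p where "p = real CARD('n) + 2 * s"
  have p: "0 \<le> p" using assms(9) by (simp add: p_def)
  have \<Omega>: "open \<Omega>" "bounded \<Omega>" "\<Omega> \<noteq> {}" by fact+
  have fin: "\<Omega> \<in> lmeasurable" using \<Omega> by (simp add: lmeasurable_open)
  then have meas: "\<Omega> \<in> sets lebesgue" by blast
  have pos: "0 < measure lebesgue \<Omega>"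
    using fin \<Omega>(1,3) open_not_negligible[of \<Omega>]
    by (metis measure_nonneg negligible_iff_measure0 order_less_le)
  have uL: "u \<in> L1_loc" and uM: "Linfty_norm_on \<Omega> u \<le> ereal M"
    and um: "(LINT x:\<Omega>|lebesgue. u x) = m"
    using assms(13) by (auto simp: admissible_def)
  note u = L1_loc_borel_measurable[OF uL]
  note M = Linfty_norm_on_AE[OF meas uM]
  define A where "A x = (LINT y:\<Omega>|lebesgue. 1 / norm (x - y) powr p)" for x :: "real ^ 'n"
  define t where "t x = (LINT y:\<Omega>|lebesgue. u y / norm (x - y) powr p) / A x" for x :: "real ^ 'n"
  define v where "v x = (if x \<in> closure \<Omega> then u x else t x)" for x
  have v: "v \<in> borel_measurable lebesgue"
    unfolding v_def[abs_def] t_def A_def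
    by (rule borel_measurable_kernel_mean_replacement[OF \<Omega> p u M])
  have t_le: "\<bar>t x\<bar> \<le> M" if "x \<notin> closure \<Omega>" for x
    using abs_kernel_mean_le[OF \<Omega> p u M that] by (simp add: t_def A_def)
  have A_pos: "0 < A x" if "x \<notin> closure \<Omega>" for x
    using kernel_mass_pos[OF \<Omega> p u M that] by (simp add: A_def)
  have excess_meas: "(\<lambda>y. ennreal (A y * \<bar>u y - t y\<bar>\<^sup>2)) \<in> borel_measurable lebesgue"
    using borel_measurable_kernel_excess[OF \<Omega> p u M] by (simp add: t_def A_def)
  define X where "X = (\<integral>\<^sup>+y\<in>-closure \<Omega>. ennreal (A y * \<bar>u y - t y\<bar>\<^sup>2) \<partial>lebesgue)"
  define ext where "ext f = (\<integral>\<^sup>+x\<in>\<Omega>. (\<integral>\<^sup>+y\<in>-\<Omega>.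
      ennreal (\<bar>f x - f y\<bar>\<^sup>2 / norm (x - y) powr p) \<partial>lebesgue) \<partial>lebesgue)" for f :: "real ^ 'n \<Rightarrow> real"
  have split: "ext u = ext v + X"
    unfolding ext_def X_def v_def t_def A_def by (rule exterior_energy_split[OF \<Omega> p u M])
  have uv: "v x = u x" if "x \<in> \<Omega>" for x
    using that closure_subset[of \<Omega>] by (auto simp: v_def)

  \<comment> \<open>Only local integrability concerns the changed values, and these are bounded by
    \<open>M\<close> because a weighted mean obeys the bound on \<open>u\<close> in
    \<open>\<Omega>\<close>.\<close>
  have v_adm: "v \<in> admissible M m \<Omega>"
    unfolding admissible_def
  proof (intro CollectI conjI)
    show "v \<in> L1_loc"
      using \<open>1 < M\<close> t_le by (intro L1_loc_bounded_modification[OF uL v, of M]) (auto simp: v_def)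
    show "Linfty_norm_on \<Omega> v \<le> ereal M"
      by (rule Linfty_norm_on_le[OF meas v]) (use M uv in \<open>auto elim: eventually_mono\<close>)
    show "(LINT x:\<Omega>|lebesgue. v x) = m"
      unfolding um[symmetric] set_lebesgue_integral_def
      by (intro Bochner_Integration.integral_cong) (auto simp: uv indicator_def)
  qed

  \<comment> \<open>The constant of mass \<open>m\<close>. The restriction on \<open>m\<close> gives
    \<open>\<bar>c\<bar> \<le> 1\<close>, which is below \<open>M\<close>.\<close>
  define c where "c = m / measure lebesgue \<Omega>"
  have "\<bar>c\<bar> \<le> 1" using assms(7,8) pos by (simp add: c_def abs_le_iff field_simps)
  have "(\<lambda>_. c) \<in> admissible M m \<Omega>"
    unfolding admissible_def
  proof (intro CollectI conjI)
    show "(\<lambda>_. c) \<in> (L1_loc :: (real ^ 'n \<Rightarrow> real) set)"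
      by (simp add: L1_loc_def lmeasurable_compact absolutely_integrable_on_const)
    show "Linfty_norm_on \<Omega> (\<lambda>_. c) \<le> ereal M"
      using \<open>\<bar>c\<bar> \<le> 1\<close> \<open>1 < M\<close> by (intro Linfty_norm_on_le meas) auto
    show "(LINT x:\<Omega>|lebesgue. c) = m"
      using pos fin by (simp add: c_def set_lebesgue_integral_def)
  qed
  then have u_fin: "total_energy W s \<epsilon> u \<Omega> < top"
    using assms(14) total_energy_const_finite[OF fin] by (blast intro: order.strict_trans1)

  \<comment> \<open>The energy is separated into \<open>J\<close> and \<open>Q\<close>, which see
    only the values on \<open>\<Omega>\<close> and so agree for \<open>u\<close> and
    \<open>v\<close>, and \<open>ext\<close>, which carries the whole change.\<close>
  define J where "J f = ennreal (1 / 2) * (\<integral>\<^sup>+x\<in>\<Omega>. (\<integral>\<^sup>+y\<in>\<Omega>.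
      ennreal (\<bar>f x - f y\<bar>\<^sup>2 / norm (x - y) powr p) \<partial>lebesgue) \<partial>lebesgue)" for f :: "real ^ 'n \<Rightarrow> real"
  define Q where "Q f = (\<integral>\<^sup>+x\<in>\<Omega>. ennreal (W (f x)) \<partial>lebesgue)" for f
  have energy: "total_energy W s \<epsilon> f \<Omega> =
      ennreal (kappa s \<epsilon>) * (ennreal (\<epsilon> powr (2 * s)) * (J f + ext f) + Q f)" for f
    by (simp add: total_energy_def kinetic_energy_def J_def ext_def Q_def p_def)
  have "(\<integral>\<^sup>+y\<in>\<Omega>. ennreal (\<bar>v x - v y\<bar>\<^sup>2 / norm (x - y) powr p) \<partial>lebesgue) =
      (\<integral>\<^sup>+y\<in>\<Omega>. ennreal (\<bar>u x - u y\<bar>\<^sup>2 / norm (x - y) powr p) \<partial>lebesgue)" if "x \<in> \<Omega>" for x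
    by (intro nn_integral_cong) (use that in \<open>auto simp: uv indicator_def\<close>)
  then have "J v = J u"
    unfolding J_def
    by (intro arg_cong[where f = "(*) (ennreal (1 / 2))"] nn_integral_cong) (auto simp: indicator_def)
  moreover have "Q v = Q u"
    unfolding Q_def by (intro nn_integral_cong) (auto simp: uv indicator_def)
  ultimately have "X = 0"
    using energy_excess_eq_0[of "kappa s \<epsilon>" "\<epsilon> powr (2 * s)" "J u" "ext v" X "Q u"]
      bspec[OF assms(14) v_adm] u_fin kappa_pos[OF assms(11,12)] assms(11)
    by (simp add: energy split)
  then have "AE y in lebesgue. ennreal (A y * \<bar>u y - t y\<bar>\<^sup>2) * indicator (-closure \<Omega>) y = 0"
    unfolding X_def using excess_meas by (subst (asm) nn_integral_0_iff_AE) auto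
  moreover have "frontier \<Omega> \<in> null_sets lebesgue"
    using negligible_frontier_lipschitz_set[OF \<Omega>(1) assms(4)]
    by (simp add: negligible_iff_null_sets)
  then have "AE y in lebesgue. y \<notin> frontier \<Omega>"
    by (rule AE_not_in)
  ultimately have "AE x in lebesgue. x \<in> -\<Omega> \<longrightarrow> u x = t x"
  proof eventually_elim
    case (elim y)
    show ?case
    proof
      assume "y \<in> -\<Omega>"
      with elim(2) have y: "y \<notin> closure \<Omega>"
        using \<Omega>(1) by (auto simp: frontier_def interior_open)
      \<comment> \<open>\<open>ennreal\<close> sends every nonpositive real to 0, so the vanishing
        gives only this inequality. Positivity of \<open>A y\<close> then forces the square to be
        0.\<close>
      with elim(1) have "A y * \<bar>u y - t y\<bar>\<^sup>2 \<le> 0" by (simp add: ennreal_eq_0_iff)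
      then show "u y = t y" using A_pos[OF y] by (simp add: mult_le_0_iff)
    qed
  qed
  then show ?thesis unfolding t_def A_def p_def .
qed

end
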